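(* Let $(\mathcal{K}_1,\boxdot:\mathcal{K}_1\to\mathcal{L}_1)$ and $(\mathcal{K}_2,\square:\mathcal{K}_2\to\mathcal{L}_2)$ be rigged categories, and let $\Psi:\mathcal{K}_1\to\mathcal{K}_2$ and $\Upsilon:\mathcal{L}_1\to\mathcal{L}_2$ be covariant functors such that $\Upsilon\circ\boxdot=\square\circ\Psi$. Suppose that $\Psi$ and $\Upsilon$ have left adjoint functors $\Phi:\mathcal{K}_2\to\mathcal{K}_1$ and $\Delta:\mathcal{L}_2\to\mathcal{L}_1$, respectively, and that $F$ is a free object in $\mathcal{K}_2$ with base $M\in\mathcal{L}_2$. Then $\Phi(F)$ is a free object in $\mathcal{K}_1$ with base $\Delta(M)$.
   Context: A rig of a category $\mathcal{K}$ is a faithful covariant functor $\square:\mathcal{K}\to\mathcal{L}$ to another category $\mathcal L$; the pair $(\mathcal{K},\square)$ is a rigged category. An object $F$ of $\mathcal{K}$ is free with base $M\in\mathcal{L}$ (with respect to this rigged category) if for every $X\in\mathcal{K}$ there is a bijection $\mathrm{Hom}_{\mathcal{L}}(M,\square X)\to\mathrm{Hom}_{\mathcal{K}}(F,X)$, natural in $X$. *)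

theory Defs
  imports Main
begin

record ('o, 'm) cat =
  Obj :: "'o set"
  Arr :: "'m set"
  Dom :: "'m \<Rightarrow> 'o"
  Cod :: "'m \<Rightarrow> 'o"
  Ident :: "'o \<Rightarrow> 'm"
  Comp :: "'m \<Rightarrow> 'm \<Rightarrow> 'm"  (infixl "\<cdot>\<index>" 70)

definition Hom :: "('o, 'm, 'z) cat_scheme \<Rightarrow> 'o \<Rightarrow> 'o \<Rightarrow> 'm set" where
  "Hom C A B = {f \<in> Arr C. Dom C f = A \<and> Cod C f = B}"

text \<open>
  Composition is in the applicative order: the composite of f and g, in this order, applies g
  first. It is constrained only on composable pairs of arrows; the values of the record's total
  functions outside the carriers are irrelevant.
\<close>

locale category =
  fixes C :: "('o, 'm, 'z) cat_scheme" (structure)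
  assumes Dom_in_Obj: "f \<in> Arr C \<Longrightarrow> Dom C f \<in> Obj C"
    and Cod_in_Obj: "f \<in> Arr C \<Longrightarrow> Cod C f \<in> Obj C"
    and Ident_in_Hom: "A \<in> Obj C \<Longrightarrow> Ident C A \<in> Hom C A A"
    and Comp_in_Hom: "\<lbrakk>f \<in> Hom C A B; g \<in> Hom C B D\<rbrakk> \<Longrightarrow> g \<cdot> f \<in> Hom C A D"
    and Comp_Ident_right: "f \<in> Hom C A B \<Longrightarrow> f \<cdot> Ident C A = f"
    and Comp_Ident_left: "f \<in> Hom C A B \<Longrightarrow> Ident C B \<cdot> f = f"
    and Comp_assoc:
      "\<lbrakk>f \<in> Hom C A B; g \<in> Hom C B D; h \<in> Hom C D E\<rbrakk> \<Longrightarrow> (h \<cdot> g) \<cdot> f = h \<cdot> (g \<cdot> f)"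

record ('o, 'm, 'p, 'n) cfunctor =
  on_obj :: "'o \<Rightarrow> 'p"
  on_arr :: "'m \<Rightarrow> 'n"

locale covariant_functor = source: category C + target: category D
  for C :: "('o, 'm, 'y) cat_scheme" (structure)
    and D :: "('p, 'n, 'z) cat_scheme" (structure)
    and T :: "('o, 'm, 'p, 'n) cfunctor" +
  assumes on_obj_in_Obj: "A \<in> Obj C \<Longrightarrow> on_obj T A \<in> Obj D"
    and on_arr_in_Hom: "f \<in> Hom C A B \<Longrightarrow> on_arr T f \<in> Hom D (on_obj T A) (on_obj T B)"
    and on_arr_Ident: "A \<in> Obj C \<Longrightarrow> on_arr T (Ident C A) = Ident D (on_obj T A)"
    and on_arr_Comp: "\<lbrakk>f \<in> Hom C A B; g \<in> Hom C B E\<rbrakk> \<Longrightarrow>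
      on_arr T (g \<cdot>\<^bsub>C\<^esub> f) = on_arr T g \<cdot>\<^bsub>D\<^esub> on_arr T f"

definition functor_comp ::
    "('p, 'n, 'q, 'l) cfunctor \<Rightarrow> ('o, 'm, 'p, 'n) cfunctor \<Rightarrow> ('o, 'm, 'q, 'l) cfunctor" where
  "functor_comp S T = \<lparr>on_obj = on_obj S \<circ> on_obj T, on_arr = on_arr S \<circ> on_arr T\<rparr>"

text \<open>
  Equality of functors out of C: since functors are represented by total functions, only their
  values on the objects and arrows of C are compared.
\<close>

definition functor_eq ::
    "('o, 'm, 'z) cat_scheme \<Rightarrow> ('o, 'm, 'p, 'n) cfunctor \<Rightarrow> ('o, 'm, 'p, 'n) cfunctor \<Rightarrow> bool"
  where
  "functor_eq C S T \<longleftrightarrow>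
    (\<forall>A\<in>Obj C. on_obj S A = on_obj T A) \<and> (\<forall>f\<in>Arr C. on_arr S f = on_arr T f)"

locale rigged_category = covariant_functor K L R
  for K :: "('o, 'm, 'y) cat_scheme" (structure)
    and L :: "('p, 'n, 'z) cat_scheme" (structure)
    and R :: "('o, 'm, 'p, 'n) cfunctor" +
  assumes faithful: "\<lbrakk>A \<in> Obj K; B \<in> Obj K\<rbrakk> \<Longrightarrow> inj_on (on_arr R) (Hom K A B)"

definition free_with_base ::
    "('o, 'm, 'y) cat_scheme \<Rightarrow> ('p, 'n, 'z) cat_scheme \<Rightarrow> ('o, 'm, 'p, 'n) cfunctor
      \<Rightarrow> 'o \<Rightarrow> 'p \<Rightarrow> bool" where
  "free_with_base K L R F M \<longleftrightarrow> F \<in> Obj K \<and> M \<in> Obj L \<and>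
    (\<exists>\<beta>. (\<forall>X\<in>Obj K. bij_betw (\<beta> X) (Hom L M (on_obj R X)) (Hom K F X)) \<and>
      (\<forall>X\<in>Obj K. \<forall>Y\<in>Obj K. \<forall>f\<in>Hom K X Y. \<forall>g\<in>Hom L M (on_obj R X).
        \<beta> Y (on_arr R f \<cdot>\<^bsub>L\<^esub> g) = f \<cdot>\<^bsub>K\<^esub> \<beta> X g))"

text \<open>
  S from D to C is left adjoint to T from C to D: bijections
  Hom C (S A) X \<rightarrow> Hom D A (T X) natural in X (second conjunct) and in A (third conjunct).
\<close>

definition left_adjoint ::
    "('o, 'm, 'y) cat_scheme \<Rightarrow> ('p, 'n, 'z) cat_scheme
      \<Rightarrow> ('p, 'n, 'o, 'm) cfunctor \<Rightarrow> ('o, 'm, 'p, 'n) cfunctor \<Rightarrow> bool" where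
  "left_adjoint C D S T \<longleftrightarrow> covariant_functor D C S \<and> covariant_functor C D T \<and>
    (\<exists>\<alpha>. (\<forall>A\<in>Obj D. \<forall>X\<in>Obj C.
          bij_betw (\<alpha> A X) (Hom C (on_obj S A) X) (Hom D A (on_obj T X))) \<and>
      (\<forall>A\<in>Obj D. \<forall>X\<in>Obj C. \<forall>Y\<in>Obj C. \<forall>f\<in>Hom C X Y. \<forall>g\<in>Hom C (on_obj S A) X.
          \<alpha> A Y (f \<cdot>\<^bsub>C\<^esub> g) = on_arr T f \<cdot>\<^bsub>D\<^esub> \<alpha> A X g) \<and>
      (\<forall>A\<in>Obj D. \<forall>B\<in>Obj D. \<forall>X\<in>Obj C. \<forall>h\<in>Hom D B A. \<forall>g\<in>Hom C (on_obj S A) X.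
          \<alpha> B X (g \<cdot>\<^bsub>C\<^esub> on_arr S h) = \<alpha> A X g \<cdot>\<^bsub>D\<^esub> h))"

end

theory Submission
  imports Defs
begin

text \<open>
  For an object X of the first category there is a chain of natural bijections, where the middle
  identification uses that the functors commute with the rigs:
  Hom(\<Delta> M, R1 X) = Hom(M, \<Upsilon> (R1 X)) = Hom(M, R2 (\<Psi> X)) = Hom(F, \<Psi> X) = Hom(\<Phi> F, X).
\<close>

text \<open>The adjunctions are read only at one fixed object each, \<open>F\<close> and
  \<open>M\<close>. Fixing \<open>A\<close> turns the two-index family into a family in
  \<open>X\<close> alone, natural in \<open>X\<close>, which is the shape that
  \<open>free_with_base\<close> asks for.\<close>

lemma left_adjointE:
  assumes "left_adjoint C D S T" and "A \<in> Obj D"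
  obtains \<alpha> where
    "\<And>X. X \<in> Obj C \<Longrightarrow> bij_betw (\<alpha> X) (Hom C (on_obj S A) X) (Hom D A (on_obj T X))"
    "\<And>X Y f g. \<lbrakk>X \<in> Obj C; Y \<in> Obj C; f \<in> Hom C X Y; g \<in> Hom C (on_obj S A) X\<rbrakk> \<Longrightarrow>
      \<alpha> Y (f \<cdot>\<^bsub>C\<^esub> g) = on_arr T f \<cdot>\<^bsub>D\<^esub> \<alpha> X g"
  using assms unfolding left_adjoint_def by meson

theorem proposition4p5:
  fixes K1 :: "('o1, 'm1) cat" and L1 :: "('p1, 'n1) cat"
    and K2 :: "('o2, 'm2) cat" and L2 :: "('p2, 'n2) cat"
    and R1 :: "('o1, 'm1, 'p1, 'n1) cfunctor"
    and R2 :: "('o2, 'm2, 'p2, 'n2) cfunctor"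
    and \<Psi> :: "('o1, 'm1, 'o2, 'm2) cfunctor"
    and \<Upsilon> :: "('p1, 'n1, 'p2, 'n2) cfunctor"
    and \<Phi> :: "('o2, 'm2, 'o1, 'm1) cfunctor"
    and \<Delta> :: "('p2, 'n2, 'p1, 'n1) cfunctor"
    and F :: 'o2 and M :: 'p2
  assumes "rigged_category K1 L1 R1"
    and "rigged_category K2 L2 R2"
    and "covariant_functor K1 K2 \<Psi>"
    and "covariant_functor L1 L2 \<Upsilon>"
    and "functor_eq K1 (functor_comp \<Upsilon> R1) (functor_comp R2 \<Psi>)"
    and "left_adjoint K1 K2 \<Phi> \<Psi>"
    and "left_adjoint L1 L2 \<Delta> \<Upsilon>"
    and "free_with_base K2 L2 R2 F M"
  shows "free_with_base K1 L1 R1 (on_obj \<Phi> F) (on_obj \<Delta> M)"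
proof -
  interpret R1: rigged_category K1 L1 R1 by fact
  interpret \<Psi>: covariant_functor K1 K2 \<Psi> by fact
  have F: "F \<in> Obj K2" and M: "M \<in> Obj L2"
    using assms(8) by (auto simp: free_with_base_def)
  interpret \<Phi>: covariant_functor K2 K1 \<Phi>
    using assms(6) by (simp add: left_adjoint_def)
  interpret \<Delta>: covariant_functor L2 L1 \<Delta>
    using assms(7) by (simp add: left_adjoint_def)
  have square_obj: "on_obj \<Upsilon> (on_obj R1 X) = on_obj R2 (on_obj \<Psi> X)" if "X \<in> Obj K1" for X
    using assms(5) that by (simp add: functor_eq_def functor_comp_def)
  \<comment> \<open>\<open>functor_eq\<close> compares values only on the carriers; membership in a
    Hom-set supplies \<open>f \<in> Arr K1\<close>.\<close>
  have square_arr: "on_arr \<Upsilon> (on_arr R1 f) = on_arr R2 (on_arr \<Psi> f)" if "f \<in> Hom K1 X Y" for f X Y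
    using assms(5) that by (simp add: functor_eq_def functor_comp_def Hom_def)
  obtain \<alpha> where
    \<alpha>_bij: "\<And>X. X \<in> Obj K1 \<Longrightarrow> bij_betw (\<alpha> X) (Hom K1 (on_obj \<Phi> F) X) (Hom K2 F (on_obj \<Psi> X))" and
    \<alpha>_nat: "\<And>X Y f g. \<lbrakk>X \<in> Obj K1; Y \<in> Obj K1; f \<in> Hom K1 X Y; g \<in> Hom K1 (on_obj \<Phi> F) X\<rbrakk> \<Longrightarrow>
      \<alpha> Y (f \<cdot>\<^bsub>K1\<^esub> g) = on_arr \<Psi> f \<cdot>\<^bsub>K2\<^esub> \<alpha> X g"
    using left_adjointE[OF assms(6) F] by metis
  obtain \<delta> where
    \<delta>_bij: "\<And>X. X \<in> Obj L1 \<Longrightarrow> bij_betw (\<delta> X) (Hom L1 (on_obj \<Delta> M) X) (Hom L2 M (on_obj \<Upsilon> X))" and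
    \<delta>_nat: "\<And>X Y f g. \<lbrakk>X \<in> Obj L1; Y \<in> Obj L1; f \<in> Hom L1 X Y; g \<in> Hom L1 (on_obj \<Delta> M) X\<rbrakk> \<Longrightarrow>
      \<delta> Y (f \<cdot>\<^bsub>L1\<^esub> g) = on_arr \<Upsilon> f \<cdot>\<^bsub>L2\<^esub> \<delta> X g"
    using left_adjointE[OF assms(7) M] by metis
  obtain \<beta> where
    \<beta>_bij: "\<And>X. X \<in> Obj K2 \<Longrightarrow> bij_betw (\<beta> X) (Hom L2 M (on_obj R2 X)) (Hom K2 F X)" and
    \<beta>_nat: "\<And>X Y f g. \<lbrakk>X \<in> Obj K2; Y \<in> Obj K2; f \<in> Hom K2 X Y; g \<in> Hom L2 M (on_obj R2 X)\<rbrakk> \<Longrightarrow>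
      \<beta> Y (on_arr R2 f \<cdot>\<^bsub>L2\<^esub> g) = f \<cdot>\<^bsub>K2\<^esub> \<beta> X g"
    using assms(8) unfolding free_with_base_def by meson
  \<comment> \<open>The first three links of the chain, ending in Hom(F, \<Psi> X). The two factors
    compose because \<open>square_obj\<close> identifies the codomain of
    \<open>\<delta> (on_obj R1 X)\<close> with the domain of
    \<open>\<beta> (on_obj \<Psi> X)\<close>.\<close>
  define \<eta> where "\<eta> X = \<beta> (on_obj \<Psi> X) \<circ> \<delta> (on_obj R1 X)" for X
  \<comment> \<open>The last link is inverted: \<alpha> leads out of Hom(\<Phi> F, X), whereas
    freeness needs a bijection into it.\<close>
  define \<gamma> where "\<gamma> X = inv_into (Hom K1 (on_obj \<Phi> F) X) (\<alpha> X) \<circ> \<eta> X" for X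
  have \<eta>_bij: "bij_betw (\<eta> X) (Hom L1 (on_obj \<Delta> M) (on_obj R1 X)) (Hom K2 F (on_obj \<Psi> X))"
    if "X \<in> Obj K1" for X
    unfolding \<eta>_def
    using \<delta>_bij[OF R1.on_obj_in_Obj[OF that]] \<beta>_bij[OF \<Psi>.on_obj_in_Obj[OF that]]
    by (auto simp: square_obj[OF that] intro: bij_betw_trans)
  have \<gamma>_bij: "bij_betw (\<gamma> X) (Hom L1 (on_obj \<Delta> M) (on_obj R1 X)) (Hom K1 (on_obj \<Phi> F) X)"
    if "X \<in> Obj K1" for X
    unfolding \<gamma>_def using \<eta>_bij[OF that] bij_betw_inv_into[OF \<alpha>_bij[OF that]]
    by (rule bij_betw_trans)
  \<comment> \<open>This equation characterizes \<gamma>, so the inverse need not be unfolded again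
    and naturality of \<alpha> itself suffices.\<close>
  have \<alpha>_\<gamma>: "\<alpha> X (\<gamma> X g) = \<eta> X g"
    if "X \<in> Obj K1" "g \<in> Hom L1 (on_obj \<Delta> M) (on_obj R1 X)" for X g
    unfolding \<gamma>_def
    using bij_betw_inv_into_right[OF \<alpha>_bij[OF that(1)] bij_betwE[OF \<eta>_bij[OF that(1)], rule_format, OF that(2)]]
    by simp
  have \<gamma>_nat: "\<gamma> Y (on_arr R1 f \<cdot>\<^bsub>L1\<^esub> g) = f \<cdot>\<^bsub>K1\<^esub> \<gamma> X g"
    if X: "X \<in> Obj K1" and Y: "Y \<in> Obj K1" and f: "f \<in> Hom K1 X Y"
      and g: "g \<in> Hom L1 (on_obj \<Delta> M) (on_obj R1 X)" for X Y f g
  \<comment> \<open>Both sides are compared after applying the injective map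
    \<open>\<alpha> Y\<close>; the two memberships shown at the end are the side conditions of
    injectivity.\<close>
  proof (rule inj_onD[OF bij_betw_imp_inj_on[OF \<alpha>_bij[OF Y]]])
    have \<gamma>g: "\<gamma> X g \<in> Hom K1 (on_obj \<Phi> F) X"
      using bij_betwE[OF \<gamma>_bij[OF X]] g by blast
    have \<delta>g: "\<delta> (on_obj R1 X) g \<in> Hom L2 M (on_obj R2 (on_obj \<Psi> X))"
      using bij_betwE[OF \<delta>_bij[OF R1.on_obj_in_Obj[OF X]]] g by (simp add: square_obj[OF X])
    have fg: "on_arr R1 f \<cdot>\<^bsub>L1\<^esub> g \<in> Hom L1 (on_obj \<Delta> M) (on_obj R1 Y)"
      using g R1.on_arr_in_Hom[OF f] by (rule R1.target.Comp_in_Hom)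
    have "\<alpha> Y (\<gamma> Y (on_arr R1 f \<cdot>\<^bsub>L1\<^esub> g)) = \<eta> Y (on_arr R1 f \<cdot>\<^bsub>L1\<^esub> g)"
      using Y fg by (rule \<alpha>_\<gamma>)
    \<comment> \<open>Naturality of \<delta> along \<open>on_arr R1 f\<close> produces \<Upsilon>
      (R1 f); the commuting square rewrites it as R2 (\<Psi> f), the form in which naturality of
      \<beta> along \<Psi> f applies next.\<close>
    also have "\<dots> = \<beta> (on_obj \<Psi> Y) (on_arr R2 (on_arr \<Psi> f) \<cdot>\<^bsub>L2\<^esub> \<delta> (on_obj R1 X) g)"
      by (simp add: \<eta>_def square_arr[OF f]
          \<delta>_nat[OF R1.on_obj_in_Obj[OF X] R1.on_obj_in_Obj[OF Y] R1.on_arr_in_Hom[OF f] g])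
    also have "\<dots> = on_arr \<Psi> f \<cdot>\<^bsub>K2\<^esub> \<eta> X g"
      by (simp add: \<eta>_def
          \<beta>_nat[OF \<Psi>.on_obj_in_Obj[OF X] \<Psi>.on_obj_in_Obj[OF Y] \<Psi>.on_arr_in_Hom[OF f] \<delta>g])
    \<comment> \<open>Naturality of \<alpha>, read from right to left, after replacing
      \<open>\<eta> X g\<close> by \<open>\<alpha> X (\<gamma> X g)\<close>.\<close>
    also have "\<dots> = \<alpha> Y (f \<cdot>\<^bsub>K1\<^esub> \<gamma> X g)"
      by (simp add: \<alpha>_nat[OF X Y f \<gamma>g] \<alpha>_\<gamma>[OF X g])
    finally show "\<alpha> Y (\<gamma> Y (on_arr R1 f \<cdot>\<^bsub>L1\<^esub> g)) = \<alpha> Y (f \<cdot>\<^bsub>K1\<^esub> \<gamma> X g)" .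
    show "\<gamma> Y (on_arr R1 f \<cdot>\<^bsub>L1\<^esub> g) \<in> Hom K1 (on_obj \<Phi> F) Y"
      using bij_betwE[OF \<gamma>_bij[OF Y]] fg by blast
    show "f \<cdot>\<^bsub>K1\<^esub> \<gamma> X g \<in> Hom K1 (on_obj \<Phi> F) Y"
      using \<gamma>g f by (rule R1.source.Comp_in_Hom)
  qed
  show ?thesis
    unfolding free_with_base_def
    using \<Phi>.on_obj_in_Obj[OF F] \<Delta>.on_obj_in_Obj[OF M] \<gamma>_bij \<gamma>_nat by blast
qed

end
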